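(* Let $\mathcal{H}$ be a Hilbert space with an inner product $(\cdot,\cdot)_{\mathcal{H}}$. Let $\mathcal{A},\mathcal{B}$ be two non-negative self-adjoint operators in $\mathcal{H}$ with discrete spectra $\operatorname{Spec}(\mathcal{A})=\{\alpha_1\le\alpha_2\le\dots\}$ and $\operatorname{Spec}(\mathcal{B})=\{\beta_1\le\beta_2\le\dots\}$ and corresponding orthonormal bases of eigenfunctions $\{a_k\}$, $\{b_k\}$. Assume additionally that $a_k\in\operatorname{Dom}(\mathcal{B})$ and $b_k\in\operatorname{Dom}(\mathcal{A}^2)$ for all $k\in\mathbb{N}$, where the domains are understood in the sense of quadratic forms. Suppose that for some $C>0$ $$\left|(\mathcal{A}u,\mathcal{A}u)_{\mathcal{H}}-(\mathcal{B}u,u)_{\mathcal{H}}\right|\le C(\mathcal{A}u,u)_{\mathcal{H}}\qquad\text{for all }u\in D:=\operatorname{Dom}(\mathcal{B})\cap\operatorname{Dom}(\mathcal{A}^2).$$ Then $$\left|\alpha_k^2-\beta_k\right|\le C\alpha_k$$ and consequently $$\left|\alpha_k-\sqrt{\beta_k}\right|\le C$$ for all $k\in\mathbb{N}$, with the same constant $C$.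
   Context: Eigenvalues are listed in non-decreasing order and repeated according to multiplicity; $\mathcal{A}a_k=\alpha_k a_k$ and $\mathcal{B}b_k=\beta_k b_k$. Domains in the sense of quadratic forms: $\operatorname{Dom}(\mathcal{B})$ denotes the domain of the quadratic form of $\mathcal{B}$ (the operator domain of $\mathcal{B}^{1/2}$), and $(\mathcal{B}u,u)_{\mathcal{H}}$ is the value of this form; $\operatorname{Dom}(\mathcal{A}^2)$ denotes the domain of the quadratic form $(\mathcal{A}u,\mathcal{A}u)_{\mathcal{H}}$ of $\mathcal{A}^2$, i.e. the operator domain of $\mathcal{A}$. *)

theory Defs
  imports "HOL-Analysis.Analysis"
begin

text \<open>
  The scalar field is kept generic so that real and complex Hilbert spaces are both covered: by
  the Gelfand--Mazur theorem the fields of the following class are exactly the reals (with trivial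
  conjugation) and the complex numbers (with complex conjugation).
\<close>

class rc_field = real_normed_field +
  fixes kcnj :: "'a \<Rightarrow> 'a"
    and kre :: "'a \<Rightarrow> real"
  assumes kcnj_add: "kcnj (x + y) = kcnj x + kcnj y"
    and add_kcnj: "x + kcnj x = (2 * kre x) *\<^sub>R 1"
    and mult_kcnj: "x * kcnj x = (norm x)\<^sup>2 *\<^sub>R 1"

instantiation real :: rc_field
begin
definition kcnj_real :: "real \<Rightarrow> real" where "kcnj_real x = x"
definition kre_real :: "real \<Rightarrow> real" where "kre_real x = x"
instance
  by standard (auto simp: kcnj_real_def kre_real_def power2_eq_square)
end

instantiation complex :: rc_field
begin
definition kcnj_complex :: "complex \<Rightarrow> complex" where "kcnj_complex = cnj"
definition kre_complex :: "complex \<Rightarrow> real" where "kre_complex = Re"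
instance
  by standard (auto simp: kcnj_complex_def kre_complex_def complex_add_cnj scaleR_conv_of_real
      complex_norm_square simp del: of_real_power)
end

text \<open>
  A Hilbert space over \<open>'k\<close>.  Norm, topology and completeness are those of the underlying real
  Hilbert space \<open>'a\<close>; \<open>ip_self\<close> says that this norm is the one induced by \<open>ip\<close>, so that by
  polarization \<open>kre (ip x y)\<close> is the real inner product of the class.
  The inner product is linear in its first argument.
\<close>

locale hilbert_space = vector_space sc
  for sc :: "'k::rc_field \<Rightarrow> 'a::{real_inner, complete_space} \<Rightarrow> 'a" +
  fixes ip :: "'a \<Rightarrow> 'a \<Rightarrow> 'k"
  assumes scale_of_real: "sc (of_real r) x = r *\<^sub>R x"
    and ip_add_left: "ip (x + y) z = ip x z + ip y z"
    and ip_scale_left: "ip (sc c x) y = c * ip x y"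
    and ip_commute: "ip y x = kcnj (ip x y)"
    and ip_self: "ip x x = of_real ((norm x)\<^sup>2)"

text \<open>
  A possibly unbounded operator: only the values of \<open>app A\<close> on \<open>Dom A\<close> are meaningful.
\<close>

datatype 'a part_op = Part_Op (Dom: "'a set") (app: "'a \<Rightarrow> 'a")

definition linear_op :: "('k::rc_field \<Rightarrow> 'a::real_inner \<Rightarrow> 'a) \<Rightarrow> 'a part_op \<Rightarrow> bool" where
  "linear_op sc A \<longleftrightarrow>
     module.subspace sc (Dom A) \<and>
     (\<forall>x\<in>Dom A. \<forall>y\<in>Dom A. app A (x + y) = app A x + app A y) \<and>
     (\<forall>c. \<forall>x\<in>Dom A. app A (sc c x) = sc c (app A x))"

text \<open>
  The left-hand side of the equivalence says that \<open>(y, z)\<close> lies in the graph of the adjoint of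
  \<open>A\<close>, the right-hand side that it lies in the graph of \<open>A\<close>; in particular the domains agree.
\<close>

definition self_adjoint ::
    "('k::rc_field \<Rightarrow> 'a::real_inner \<Rightarrow> 'a) \<Rightarrow> ('a \<Rightarrow> 'a \<Rightarrow> 'k) \<Rightarrow> 'a part_op \<Rightarrow> bool" where
  "self_adjoint sc ip A \<longleftrightarrow>
     linear_op sc A \<and> closure (Dom A) = UNIV \<and>
     (\<forall>y z. (\<forall>x\<in>Dom A. ip (app A x) y = ip x z) \<longleftrightarrow> y \<in> Dom A \<and> z = app A y)"

text \<open>
  For a self-adjoint operator \<open>ip (app A x) x\<close> is real, so taking \<open>kre\<close> only changes its type.
\<close>

definition nonneg_self_adjoint ::
    "('k::rc_field \<Rightarrow> 'a::real_inner \<Rightarrow> 'a) \<Rightarrow> ('a \<Rightarrow> 'a \<Rightarrow> 'k) \<Rightarrow> 'a part_op \<Rightarrow> bool" where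
  "nonneg_self_adjoint sc ip A \<longleftrightarrow>
     self_adjoint sc ip A \<and> (\<forall>x\<in>Dom A. 0 \<le> kre (ip (app A x) x))"

definition spectrum ::
    "('k::rc_field \<Rightarrow> 'a::real_inner \<Rightarrow> 'a) \<Rightarrow> 'a part_op \<Rightarrow> 'k set" where
  "spectrum sc A =
     {\<mu>. \<not> (bij_betw (\<lambda>x. app A x - sc \<mu> x) (Dom A) UNIV \<and>
            (\<exists>M. \<forall>x\<in>Dom A. norm x \<le> M * norm (app A x - sc \<mu> x)))}"

definition eigenspace ::
    "('k::rc_field \<Rightarrow> 'a::real_inner \<Rightarrow> 'a) \<Rightarrow> 'a part_op \<Rightarrow> 'k \<Rightarrow> 'a set" where
  "eigenspace sc A \<mu> = {x \<in> Dom A. app A x = sc \<mu> x}"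

definition discrete_spectrum ::
    "('k::rc_field \<Rightarrow> 'a::real_inner \<Rightarrow> 'a) \<Rightarrow> 'a part_op \<Rightarrow> bool" where
  "discrete_spectrum sc A \<longleftrightarrow>
     (\<forall>\<mu>\<in>spectrum sc A.
        \<mu> isolated_in spectrum sc A \<and>
        eigenspace sc A \<mu> \<noteq> {0} \<and>
        (\<exists>F. finite F \<and> eigenspace sc A \<mu> \<subseteq> module.span sc F))"

definition orthonormal_basis ::
    "('k::rc_field \<Rightarrow> 'a::real_inner \<Rightarrow> 'a) \<Rightarrow> ('a \<Rightarrow> 'a \<Rightarrow> 'k) \<Rightarrow> (nat \<Rightarrow> 'a) \<Rightarrow> bool" where
  "orthonormal_basis sc ip a \<longleftrightarrow>
     (\<forall>i j. ip (a i) (a j) = (if i = j then 1 else 0)) \<and>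
     closure (module.span sc (range a)) = UNIV"

text \<open>
  \<open>\<alpha>\<close> lists the spectrum of \<open>A\<close> in non-decreasing order, with the orthonormal basis \<open>a\<close> of
  corresponding eigenvectors.  Since \<open>a\<close> is a basis, each eigenvalue occurs in \<open>\<alpha>\<close> exactly as
  often as its multiplicity.  Sequences are indexed from 0.
\<close>

definition eigen_listing ::
    "('k::rc_field \<Rightarrow> 'a::real_inner \<Rightarrow> 'a) \<Rightarrow> ('a \<Rightarrow> 'a \<Rightarrow> 'k) \<Rightarrow> 'a part_op \<Rightarrow>
     (nat \<Rightarrow> real) \<Rightarrow> (nat \<Rightarrow> 'a) \<Rightarrow> bool" where
  "eigen_listing sc ip A \<alpha> a \<longleftrightarrow>
     mono \<alpha> \<and> spectrum sc A = range (\<lambda>k. of_real (\<alpha> k)) \<and>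
     orthonormal_basis sc ip a \<and>
     (\<forall>k. a k \<in> Dom A \<and> app A (a k) = sc (of_real (\<alpha> k)) (a k))"

definition is_op_sqrt ::
    "('k::rc_field \<Rightarrow> 'a::real_inner \<Rightarrow> 'a) \<Rightarrow> ('a \<Rightarrow> 'a \<Rightarrow> 'k) \<Rightarrow> 'a part_op \<Rightarrow> 'a part_op \<Rightarrow> bool" where
  "is_op_sqrt sc ip B S \<longleftrightarrow>
     nonneg_self_adjoint sc ip S \<and>
     Dom B = {x \<in> Dom S. app S x \<in> Dom S} \<and>
     (\<forall>x\<in>Dom B. app B x = app S (app S x))"

text \<open>
  The non-negative square root of a non-negative self-adjoint operator exists, and its domain and
  its values on that domain are unique; the choice only affects the irrelevant values of \<open>app\<close>
  outside the domain.
\<close>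

definition op_sqrt ::
    "('k::rc_field \<Rightarrow> 'a::real_inner \<Rightarrow> 'a) \<Rightarrow> ('a \<Rightarrow> 'a \<Rightarrow> 'k) \<Rightarrow> 'a part_op \<Rightarrow> 'a part_op" where
  "op_sqrt sc ip B = (SOME S. is_op_sqrt sc ip B S)"

text \<open>The quadratic form of \<open>B\<close>, which extends \<open>ip (app B u) u\<close> from \<open>Dom B\<close> to the form domain.\<close>

definition form_dom ::
    "('k::rc_field \<Rightarrow> 'a::real_inner \<Rightarrow> 'a) \<Rightarrow> ('a \<Rightarrow> 'a \<Rightarrow> 'k) \<Rightarrow> 'a part_op \<Rightarrow> 'a set" where
  "form_dom sc ip B = Dom (op_sqrt sc ip B)"

definition form_val ::
    "('k::rc_field \<Rightarrow> 'a::real_inner \<Rightarrow> 'a) \<Rightarrow> ('a \<Rightarrow> 'a \<Rightarrow> 'k) \<Rightarrow> 'a part_op \<Rightarrow> 'a \<Rightarrow> 'k" where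
  "form_val sc ip B u = ip (app (op_sqrt sc ip B) u) (app (op_sqrt sc ip B) u)"

end

theory Submission
  imports Defs
begin

text \<open>
  This is the min-max principle with explicit test spaces. For dimensional reasons there is a
  nonzero \<open>u\<close> in the span of \<open>a\<^sub>0, \<dots>, a\<^sub>k\<close> that is orthogonal to \<open>b\<^sub>0, \<dots>, b\<^sub>k\<^sub>-\<^sub>1\<close>.
  Parseval's identity in both bases gives
  \<open>\<beta>\<^sub>k \<parallel>u\<parallel>\<^sup>2 \<le> (Bu,u) \<le> (Au,Au) + C (Au,u) \<le> (\<alpha>\<^sub>k\<^sup>2 + C \<alpha>\<^sub>k) \<parallel>u\<parallel>\<^sup>2\<close>.
  Exchanging the roles of the bases gives \<open>\<alpha>\<^sub>k\<^sup>2 - C \<alpha>\<^sub>k \<le> \<beta>\<^sub>k\<close>: for \<open>\<alpha>\<^sub>k \<ge> C\<close> because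
  \<open>t\<^sup>2 - C t\<close> increases on \<open>t \<ge> C\<close>, and for \<open>\<alpha>\<^sub>k < C\<close> because the left-hand side is not positive.
  The form of \<open>B\<close> is the sum of \<open>\<beta>\<^sub>j |(u, b\<^sub>j)|\<^sup>2\<close> because every non-negative square
  root of \<open>B\<close> maps \<open>b\<^sub>j\<close> to \<open>\<surd>\<beta>\<^sub>j b\<^sub>j\<close>.
\<close>

section \<open>Conjugation on the scalar field\<close>

lemma kcnj_0 [simp]: "kcnj (0::'k::rc_field) = 0"
  using kcnj_add[of 0 0] by simp

text \<open>Both sides agree after multiplication by \<open>x * y\<close>, because the norm is
  multiplicative; a nonzero \<open>x * y\<close> can then be cancelled.\<close>

lemma kcnj_mult: "kcnj (x * y) = kcnj x * kcnj (y::'k::rc_field)"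
proof (cases "x = 0 \<or> y = 0")
  case False
  have "(x * y) * kcnj (x * y) = (x * kcnj x) * (y * kcnj y)"
    by (simp add: mult_kcnj norm_mult power_mult_distrib)
  also have "\<dots> = (x * y) * (kcnj x * kcnj y)" by (simp add: algebra_simps)
  finally show ?thesis using False by simp
qed auto

lemma kcnj_of_real [simp]: "kcnj (of_real r :: 'k::rc_field) = of_real r"
proof (cases "r = 0")
  case False
  have "(of_real r :: 'k) * kcnj (of_real r) = of_real r * of_real r"
    by (simp add: mult_kcnj scaleR_conv_of_real power2_eq_square)
  then show ?thesis using False by simp
qed simp

text \<open>The sum \<open>x + kcnj x\<close> is real, hence fixed by \<open>kcnj\<close>; comparing
  it with its conjugate leaves the claim.\<close>

lemma kcnj_kcnj [simp]: "kcnj (kcnj x) = (x::'k::rc_field)"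
proof -
  have "x + kcnj x = of_real (2 * kre x)"
    by (simp only: add_kcnj scaleR_conv_of_real mult_1_right)
  moreover from arg_cong[OF this, of kcnj] have "kcnj x + kcnj (kcnj x) = of_real (2 * kre x)"
    by (simp only: kcnj_add kcnj_of_real)
  ultimately have "kcnj x + kcnj (kcnj x) = kcnj x + x" by (simp only: add.commute)
  then show ?thesis by simp
qed

lemma kre_of_real [simp]: "kre (of_real r :: 'k::rc_field) = r"
proof -
  have "(of_real r :: 'k) + of_real r = of_real (2 * kre (of_real r :: 'k))"
    using add_kcnj[of "of_real r :: 'k"] by (simp add: scaleR_conv_of_real)
  then have "(of_real (2 * r) :: 'k) = of_real (2 * kre (of_real r :: 'k))" by simp
  then show ?thesis unfolding of_real_eq_iff by simp
qed

lemma mult_kcnj': "x * kcnj x = (of_real ((norm x)\<^sup>2) :: 'k::rc_field)"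
  by (simp only: mult_kcnj scaleR_conv_of_real mult_1_right)

section \<open>The scalar-valued inner product and its real part\<close>

context hilbert_space
begin

lemma ip_0_left [simp]: "ip 0 x = 0"
  using ip_add_left[of 0 0 x] by simp

lemma ip_minus_left: "ip (- x) y = - ip x y"
  using ip_add_left[of x "- x" y] by (simp add: eq_neg_iff_add_eq_0 add.commute)

lemma ip_diff_left: "ip (x - y) z = ip x z - ip y z"
  using ip_add_left[of x "- y" z] by (simp add: ip_minus_left)

lemma ip_add_right: "ip x (y + z) = ip x y + ip x z"
  by (metis ip_commute ip_add_left kcnj_add)

lemma ip_scale_right: "ip x (sc c y) = kcnj c * ip x y"
  by (metis ip_commute ip_scale_left kcnj_mult)

lemma ip_0_right [simp]: "ip x 0 = 0"
  using ip_add_right[of x 0 0] by simp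

lemma ip_sum_left: "ip (\<Sum>i\<in>I. f i) x = (\<Sum>i\<in>I. ip (f i) x)"
  by (induction I rule: infinite_finite_induct) (auto simp: ip_add_left)

lemma ip_sum_right: "ip x (\<Sum>i\<in>I. f i) = (\<Sum>i\<in>I. ip x (f i))"
  by (induction I rule: infinite_finite_induct) (auto simp: ip_add_right)

text \<open>Polarization: the square of \<open>norm (x + y)\<close> is expanded once through
  \<open>ip\<close> and once through \<open>inner\<close>. This transfers facts about the real inner
  product to \<open>ip\<close>.\<close>

lemma kre_ip: "kre (ip x y) = inner x y"
proof -
  have "of_real ((norm (x + y))\<^sup>2) = ip (x + y) (x + y)" by (simp only: ip_self)
  also have "\<dots> = ip x x + ip y y + (ip x y + kcnj (ip x y))"
    using ip_commute[of x y] by (simp add: ip_add_left ip_add_right)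
  also have "\<dots> = of_real ((norm x)\<^sup>2 + (norm y)\<^sup>2 + 2 * kre (ip x y))"
    by (simp only: ip_self add_kcnj scaleR_conv_of_real mult_1_right of_real_add)
  finally have "(norm (x + y))\<^sup>2 = (norm x)\<^sup>2 + (norm y)\<^sup>2 + 2 * kre (ip x y)"
    unfolding of_real_eq_iff .
  then show ?thesis
    by (simp add: power2_norm_eq_inner inner_add_left inner_add_right inner_commute)
qed

lemma norm_sc: "norm (sc c x) = norm c * norm x"
proof -
  have "of_real ((norm (sc c x))\<^sup>2) = (c * kcnj c) * ip x x"
    by (simp only: ip_self[symmetric] ip_scale_left ip_scale_right mult_ac)
  also have "\<dots> = of_real ((norm c * norm x)\<^sup>2)"
    by (simp only: mult_kcnj' ip_self power_mult_distrib of_real_mult)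
  finally have "(norm (sc c x))\<^sup>2 = (norm c * norm x)\<^sup>2" unfolding of_real_eq_iff .
  then show ?thesis by (simp add: power2_eq_iff_nonneg)
qed

text \<open>Multiplying \<open>x\<close> by the conjugate of \<open>ip x y\<close> makes the product
  real, so that the real Cauchy-Schwarz inequality applies; one factor \<open>norm (ip x y)\<close>
  is then cancelled.\<close>

lemma Cauchy_Schwarz_ip: "norm (ip x y) \<le> norm x * norm y"
proof (cases "ip x y = 0")
  case False
  define z where "z = ip x y"
  have "of_real ((norm z)\<^sup>2) = ip (sc (kcnj z) x) y"
    by (simp only: ip_scale_left z_def[symmetric] mult_kcnj'[symmetric] mult.commute)
  then have "(norm z)\<^sup>2 = inner (sc (kcnj z) x) y"
    by (metis kre_ip kre_of_real)
  also have "\<dots> \<le> norm (sc (kcnj z) x) * norm y" by (rule norm_cauchy_schwarz)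
  also have "\<dots> = norm z * (norm x * norm y)"
  proof -
    \<comment> \<open>Taking norms in \<open>z * kcnj z = of_real ((norm z)\<^sup>2)\<close> shows
      that conjugation preserves the norm.\<close>
    have "norm z * norm (kcnj z) = norm z * norm z"
      unfolding norm_mult[symmetric] mult_kcnj' by (simp add: norm_mult power2_eq_square)
    then show ?thesis using False by (simp add: norm_sc z_def)
  qed
  finally show ?thesis using False by (simp add: z_def power2_eq_square)
qed simp

lemma tendsto_ip_left: "(f \<longlongrightarrow> x) F \<Longrightarrow> ((\<lambda>i. ip (f i) y) \<longlongrightarrow> ip x y) F"
proof -
  assume "(f \<longlongrightarrow> x) F"
  then have "((\<lambda>i. norm (f i - x) * norm y) \<longlongrightarrow> 0) F"
    by (intro tendsto_eq_intros) (auto simp: LIM_zero_iff tendsto_norm_zero_iff)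
  then have "((\<lambda>i. ip (f i) y - ip x y) \<longlongrightarrow> 0) F"
    by (rule Lim_null_comparison[rotated]) (auto simp: Cauchy_Schwarz_ip simp flip: ip_diff_left)
  then show ?thesis by (simp add: LIM_zero_iff)
qed

lemma sums_ip_left: "f sums x \<Longrightarrow> (\<lambda>j. ip (f j) y) sums ip x y"
  unfolding sums_def ip_sum_left[symmetric] by (rule tendsto_ip_left)

subsection \<open>Orthonormal bases\<close>

abbreviation onb :: "(nat \<Rightarrow> 'a) \<Rightarrow> bool" where
  "onb \<equiv> orthonormal_basis sc ip"

lemma onb_ip: "onb e \<Longrightarrow> ip (e i) (e j) = (if i = j then 1 else 0)"
  by (simp add: orthonormal_basis_def)

lemma ip_onb_sum:
  assumes "onb e" and "finite F"
  shows "ip (\<Sum>j\<in>F. sc (d j) (e j)) (e i) = (if i \<in> F then d i else 0)"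
  using assms by (simp add: ip_sum_left ip_scale_left onb_ip if_distrib cong: if_cong)

lemma norm_onb_sum:
  assumes "onb e" and "finite F"
  shows "(norm (\<Sum>j\<in>F. sc (d j) (e j)))\<^sup>2 = (\<Sum>j\<in>F. (norm (d j))\<^sup>2)"
proof -
  have "of_real ((norm (\<Sum>j\<in>F. sc (d j) (e j)))\<^sup>2)
      = ip (\<Sum>j\<in>F. sc (d j) (e j)) (\<Sum>j\<in>F. sc (d j) (e j))"
    by (simp only: ip_self)
  also have "\<dots> = (\<Sum>i\<in>F. kcnj (d i) * ip (\<Sum>j\<in>F. sc (d j) (e j)) (e i))"
    unfolding ip_sum_right[of _ _ F] ip_scale_right ..
  also have "\<dots> = (\<Sum>i\<in>F. d i * kcnj (d i))"
    by (intro sum.cong refl) (simp only: ip_onb_sum[OF assms] if_True mult.commute)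
  also have "\<dots> = of_real (\<Sum>j\<in>F. (norm (d j))\<^sup>2)"
    by (simp only: mult_kcnj' of_real_sum)
  finally show ?thesis unfolding of_real_eq_iff .
qed

text \<open>For an orthonormal basis this is the orthogonal projection onto the span of the first
  \<open>n\<close> basis vectors, \<open>e 0\<close> to \<open>e (n - 1)\<close>.\<close>

definition partial_expansion :: "(nat \<Rightarrow> 'a) \<Rightarrow> nat \<Rightarrow> 'a \<Rightarrow> 'a" where
  "partial_expansion e n x = (\<Sum>j<n. sc (ip x (e j)) (e j))"

lemma partial_expansion_add:
  "partial_expansion e n (x + y) = partial_expansion e n x + partial_expansion e n y"
  by (simp add: partial_expansion_def ip_add_left scale_left_distrib sum.distrib)

lemma partial_expansion_scale:
  "partial_expansion e n (sc c x) = sc c (partial_expansion e n x)"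
  by (simp add: partial_expansion_def ip_scale_left scale_sum_right)

lemma partial_expansion_diff:
  "partial_expansion e n (x - y) = partial_expansion e n x - partial_expansion e n y"
  using partial_expansion_add[of e n "x - y" y] by simp

text \<open>Pythagoras: the remainder is orthogonal to each of the first \<open>n\<close> basis
  vectors, hence to the projection itself.\<close>

lemma norm_partial_expansion:
  assumes "onb e"
  shows "(norm (x - partial_expansion e n x))\<^sup>2 = (norm x)\<^sup>2 - (\<Sum>j<n. (norm (ip x (e j)))\<^sup>2)"
proof -
  define s where "s = partial_expansion e n x"
  have "ip (x - s) (e j) = 0" if "j < n" for j
    using that by (simp add: s_def partial_expansion_def ip_diff_left ip_onb_sum[OF assms])
  then have "ip (x - s) s = 0"
    by (subst (2) s_def) (simp add: partial_expansion_def ip_sum_right ip_scale_right)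
  then have "inner (x - s) s = 0" using kre_of_real[of 0] by (simp flip: kre_ip)
  then have "(norm (x - s))\<^sup>2 = (norm x)\<^sup>2 - (norm s)\<^sup>2"
    unfolding power2_norm_eq_inner by (simp add: inner_diff_left inner_diff_right inner_commute)
  moreover have "(norm s)\<^sup>2 = (\<Sum>j<n. (norm (ip x (e j)))\<^sup>2)"
    by (simp add: s_def partial_expansion_def norm_onb_sum[OF assms])
  ultimately show ?thesis by (simp add: s_def)
qed

lemma eventually_partial_expansion_eq:
  assumes "onb e" and "y \<in> span (range e)"
  shows "\<forall>\<^sub>F n in sequentially. partial_expansion e n y = y"
  using assms(2)
proof (induction rule: span_induct_alt)
  case (step c y z)
  then obtain i where i: "y = e i" by blast
  have "\<forall>\<^sub>F n in sequentially. partial_expansion e n (e i) = e i"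
    using eventually_gt_at_top[of i]
    by eventually_elim
      (simp add: partial_expansion_def onb_ip[OF assms(1)] if_distrib[of "\<lambda>c. sc c _"] cong: if_cong)
  with step(2) show ?case
    by eventually_elim (simp add: i partial_expansion_add partial_expansion_scale)
qed (simp add: partial_expansion_def)

text \<open>By density some \<open>y\<close> in the span is close to \<open>x\<close>, and the
  projections eventually fix \<open>y\<close>. From then on the remainder of \<open>x\<close> equals
  that of \<open>x - y\<close>, and its norm is at most \<open>norm (x - y)\<close>.\<close>

lemma onb_expansion:
  assumes "onb e"
  shows "(\<lambda>j. sc (ip x (e j)) (e j)) sums x"
proof -
  have "(\<lambda>n. partial_expansion e n x) \<longlonglongrightarrow> x"
  proof (rule tendstoI)
    fix r :: real assume "r > 0"
    have "x \<in> closure (span (range e))" using assms by (simp add: orthonormal_basis_def)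
    then obtain y where y: "y \<in> span (range e)" "dist y x < r"
      using \<open>r > 0\<close> closure_approachable by blast
    show "\<forall>\<^sub>F n in sequentially. dist (partial_expansion e n x) x < r"
      using eventually_partial_expansion_eq[OF assms y(1)]
    proof eventually_elim
      case (elim n)
      have "(norm ((x - y) - partial_expansion e n (x - y)))\<^sup>2 \<le> (norm (x - y))\<^sup>2"
        by (simp add: norm_partial_expansion[OF assms] sum_nonneg)
      then have "norm (x - partial_expansion e n x) \<le> norm (x - y)"
        by (simp add: partial_expansion_diff elim norm_le_square power2_le_iff_abs_le)
      then show ?case using y(2) by (simp add: dist_norm norm_minus_commute)
    qed
  qed
  then show ?thesis by (simp add: sums_def partial_expansion_def)
qed

lemma onb_ip_sums:
  assumes "onb e"
  shows "(\<lambda>j. ip x (e j) * ip (e j) y) sums ip x y"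
  using sums_ip_left[OF onb_expansion[OF assms, of x], of y] by (simp add: ip_scale_left)

lemma Parseval:
  assumes "onb e"
  shows "(\<lambda>j. (norm (ip x (e j)))\<^sup>2) sums (norm x)\<^sup>2"
proof -
  have "(\<lambda>n. partial_expansion e n x) \<longlonglongrightarrow> x"
    using onb_expansion[OF assms, of x] by (simp add: sums_def partial_expansion_def)
  from tendsto_power[OF tendsto_norm[OF this], of 2] show ?thesis
    by (simp add: sums_def partial_expansion_def norm_onb_sum[OF assms])
qed

lemma onb_eqI:
  assumes "onb e" and "\<And>j. ip x (e j) = ip y (e j)"
  shows "x = y"
  using onb_expansion[OF assms(1), of x] onb_expansion[OF assms(1), of y]
  by (simp add: assms(2) sums_unique2)

text \<open>Completeness enters here: by orthonormality the squared norm of a block of the vector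
  series is the same block of the summable scalar series, so the partial sums are Cauchy.\<close>

lemma Riesz_Fischer:
  assumes "onb e" and "summable (\<lambda>j. (norm (d j))\<^sup>2)"
  obtains x where "\<And>j. ip x (e j) = d j"
proof -
  have "Cauchy (\<lambda>n. \<Sum>j<n. sc (d j) (e j))"
    unfolding Cauchy_altdef
  proof (intro allI impI)
    fix r :: real assume "r > 0"
    then obtain N where N: "\<And>m n. m \<ge> N \<Longrightarrow> norm (\<Sum>j=m..<n. (norm (d j))\<^sup>2) < r\<^sup>2"
      using assms(2) unfolding summable_Cauchy by (meson zero_less_power)
    have "dist (\<Sum>j<m. sc (d j) (e j)) (\<Sum>j<n. sc (d j) (e j)) < r" if "m \<ge> N" "m < n" for m n
    proof -
      have "(\<Sum>j<n. sc (d j) (e j)) - (\<Sum>j<m. sc (d j) (e j)) = (\<Sum>j=m..<n. sc (d j) (e j))"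
        using sum_diff_nat_ivl[of 0 m n "\<lambda>j. sc (d j) (e j)"] that(2)
        by (simp add: lessThan_atLeast0)
      moreover have "(norm (\<Sum>j=m..<n. sc (d j) (e j)))\<^sup>2 < r\<^sup>2"
        using N[OF that(1), of n] by (simp add: norm_onb_sum[OF assms(1)] sum_nonneg)
      then have "norm (\<Sum>j=m..<n. sc (d j) (e j)) < r"
        using \<open>r > 0\<close> by (meson less_imp_le power_less_imp_less_base)
      ultimately show ?thesis by (simp only: dist_norm norm_minus_commute[of "sum _ {..<m}"])
    qed
    then show "\<exists>N. \<forall>m\<ge>N. \<forall>n>m. dist (\<Sum>j<m. sc (d j) (e j)) (\<Sum>j<n. sc (d j) (e j)) < r"
      by blast
  qed
  then have "summable (\<lambda>j. sc (d j) (e j))"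
    by (simp add: summable_iff_convergent Cauchy_convergent_iff)
  then have x: "(\<lambda>j. sc (d j) (e j)) sums (\<Sum>j. sc (d j) (e j))" by (rule summable_sums)
  have "ip (\<Sum>j. sc (d j) (e j)) (e i) = d i" for i
  proof -
    have "(\<lambda>j. if j = i then d i else 0) sums ip (\<Sum>j. sc (d j) (e j)) (e i)"
      using sums_ip_left[OF x, of "e i"]
      by (simp add: ip_scale_left onb_ip[OF assms(1)] if_distrib cong: if_cong)
    then show ?thesis using sums_single[of i "\<lambda>_. d i"] by (rule sums_unique2)
  qed
  then show ?thesis using that by blast
qed

subsection \<open>Operators with an orthonormal basis of eigenvectors\<close>

text \<open>This is the graph of the maximal diagonal operator. Stated by coefficients, it turns
  square-summability of the scaled coefficients of \<open>x\<close> into the mere existence of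
  \<open>z\<close>.\<close>

definition diag_graph :: "(nat \<Rightarrow> 'a) \<Rightarrow> (nat \<Rightarrow> real) \<Rightarrow> 'a \<Rightarrow> 'a \<Rightarrow> bool" where
  "diag_graph e \<sigma> x z \<longleftrightarrow> (\<forall>j. ip z (e j) = of_real (\<sigma> j) * ip x (e j))"

definition diag_op :: "(nat \<Rightarrow> 'a) \<Rightarrow> (nat \<Rightarrow> real) \<Rightarrow> 'a part_op" where
  "diag_op e \<sigma> = Part_Op {x. \<exists>z. diag_graph e \<sigma> x z} (\<lambda>x. THE z. diag_graph e \<sigma> x z)"

lemma diag_graph_iff:
  assumes "onb e"
  shows "diag_graph e \<sigma> x z \<longleftrightarrow> x \<in> Dom (diag_op e \<sigma>) \<and> z = app (diag_op e \<sigma>) x"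
proof -
  have "z = z'" if "diag_graph e \<sigma> x z" "diag_graph e \<sigma> x z'" for z z'
    using that by (intro onb_eqI[OF assms]) (simp add: diag_graph_def)
  then show ?thesis unfolding diag_op_def part_op.sel
    by (smt (verit, ccfv_threshold) mem_Collect_eq the_equality)
qed

lemma diag_graph_eigenvector: "onb e \<Longrightarrow> diag_graph e \<sigma> (e i) (sc (of_real (\<sigma> i)) (e i))"
  by (auto simp: diag_graph_def ip_scale_left onb_ip)

text \<open>The numbers \<open>\<sigma> j\<close> are real, so conjugation leaves them alone and
  they move from one factor to the other in every term of the expanded inner product.\<close>

lemma diag_graph_ip:
  assumes "onb e" and "diag_graph e \<sigma> x z" and "diag_graph e \<sigma> y w"
  shows "ip z y = ip x w"
proof -
  have "ip (e j) w = of_real (\<sigma> j) * ip (e j) y" for j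
    using assms(3) ip_commute[of "e j"] by (metis diag_graph_def kcnj_mult kcnj_of_real)
  then have "(\<lambda>j. ip z (e j) * ip (e j) y) = (\<lambda>j. ip x (e j) * ip (e j) w)"
    using assms(2) by (auto simp: diag_graph_def)
  then show ?thesis using onb_ip_sums[OF assms(1)] by (metis sums_unique2)
qed

lemma diag_graph_inner_sums:
  assumes "onb e" and "diag_graph e \<sigma> x z"
  shows "(\<lambda>j. \<sigma> j * (norm (ip x (e j)))\<^sup>2) sums kre (ip z x)"
proof -
  have "(\<lambda>j. sc (ip z (e j)) (e j)) sums z" by (rule onb_expansion[OF assms(1)])
  then have "(\<lambda>j. inner (sc (ip z (e j)) (e j)) x) sums inner z x"
    by (rule bounded_linear.sums[OF bounded_linear_inner_left])
  moreover have "inner (sc (ip z (e j)) (e j)) x = \<sigma> j * (norm (ip x (e j)))\<^sup>2" for j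
  proof -
    have "ip (sc (ip z (e j)) (e j)) x = of_real (\<sigma> j) * (ip x (e j) * kcnj (ip x (e j)))"
      using assms(2) by (simp add: diag_graph_def ip_scale_left ip_commute[of "e j" x])
    also have "\<dots> = of_real (\<sigma> j * (norm (ip x (e j)))\<^sup>2)" by (simp only: mult_kcnj' of_real_mult)
    finally show ?thesis by (metis kre_ip kre_of_real)
  qed
  ultimately show ?thesis by (simp add: kre_ip)
qed

lemma diag_graph_norm_sums:
  assumes "onb e" and "diag_graph e \<sigma> x z"
  shows "(\<lambda>j. (\<sigma> j)\<^sup>2 * (norm (ip x (e j)))\<^sup>2) sums (norm z)\<^sup>2"
  using Parseval[OF assms(1), of z] assms(2)
  by (simp add: diag_graph_def norm_mult power_mult_distrib)

lemma linear_op_diag: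
  assumes "onb e"
  shows "linear_op sc (diag_op e \<sigma>)"
proof -
  note iff = diag_graph_iff[OF assms]
  have g: "diag_graph e \<sigma> x (app (diag_op e \<sigma>) x)" if "x \<in> Dom (diag_op e \<sigma>)" for x
    using that iff by blast
  have add: "diag_graph e \<sigma> (x + y) (app (diag_op e \<sigma>) x + app (diag_op e \<sigma>) y)"
    if "x \<in> Dom (diag_op e \<sigma>)" "y \<in> Dom (diag_op e \<sigma>)" for x y
    using g[OF that(1)] g[OF that(2)] by (simp add: diag_graph_def ip_add_left algebra_simps)
  have scale: "diag_graph e \<sigma> (sc c x) (sc c (app (diag_op e \<sigma>) x))"
    if "x \<in> Dom (diag_op e \<sigma>)" for x c
    using g[OF that] by (simp add: diag_graph_def ip_scale_left algebra_simps)
  have "diag_graph e \<sigma> 0 0" by (simp add: diag_graph_def)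
  with add scale show ?thesis unfolding iff linear_op_def subspace_def by simp
qed

text \<open>Testing the adjoint relation on the basis vectors alone already yields the coefficient
  relation, so the adjoint is no larger than the diagonal operator; the other inclusion is
  symmetry.\<close>

lemma self_adjoint_diag:
  assumes "onb e"
  shows "self_adjoint sc ip (diag_op e \<sigma>)"
proof -
  note iff = diag_graph_iff[OF assms]
  let ?D = "diag_op e \<sigma>"
  have lin: "linear_op sc ?D" by (rule linear_op_diag[OF assms])
  have eig: "e i \<in> Dom ?D" "app ?D (e i) = sc (of_real (\<sigma> i)) (e i)" for i
    using diag_graph_eigenvector[OF assms, of \<sigma> i] iff by metis+
  have "span (range e) \<subseteq> Dom ?D"
    using lin eig by (intro span_minimal) (auto simp: linear_op_def)
  then have "closure (Dom ?D) = UNIV"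
    using assms closure_mono unfolding orthonormal_basis_def by blast
  moreover have "(\<forall>x\<in>Dom ?D. ip (app ?D x) y = ip x z) \<longleftrightarrow> diag_graph e \<sigma> y z" for y z
  proof
    assume *: "\<forall>x\<in>Dom ?D. ip (app ?D x) y = ip x z"
    have "ip z (e j) = of_real (\<sigma> j) * ip y (e j)" for j
    proof -
      have "ip (e j) z = of_real (\<sigma> j) * ip (e j) y"
        using *[rule_format, OF eig(1)[of j]] by (simp add: eig ip_scale_left)
      then show ?thesis by (metis ip_commute kcnj_mult kcnj_of_real)
    qed
    then show "diag_graph e \<sigma> y z" by (simp add: diag_graph_def)
  next
    assume "diag_graph e \<sigma> y z"
    then show "\<forall>x\<in>Dom ?D. ip (app ?D x) y = ip x z"
      using diag_graph_ip[OF assms] iff by blast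
  qed
  ultimately show ?thesis using lin iff by (simp add: self_adjoint_def)
qed

lemma nonneg_self_adjoint_diag:
  assumes "onb e" and "\<And>j. 0 \<le> \<sigma> j"
  shows "nonneg_self_adjoint sc ip (diag_op e \<sigma>)"
  unfolding nonneg_self_adjoint_def
proof (intro conjI ballI self_adjoint_diag[OF assms(1)])
  fix x assume "x \<in> Dom (diag_op e \<sigma>)"
  then have "diag_graph e \<sigma> x (app (diag_op e \<sigma>) x)" using diag_graph_iff[OF assms(1)] by blast
  from sums_le[OF _ sums_zero diag_graph_inner_sums[OF assms(1) this]]
  show "0 \<le> kre (ip (app (diag_op e \<sigma>) x) x)" using assms(2) by simp
qed

lemma self_adjoint_symmetric:
  assumes "self_adjoint sc ip T" and "x \<in> Dom T" and "y \<in> Dom T"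
  shows "ip (app T x) y = ip x (app T y)"
  using assms by (auto simp: self_adjoint_def)

lemma self_adjoint_eigenbasis_graph:
  assumes "self_adjoint sc ip T"
    and "\<And>k. e k \<in> Dom T" and "\<And>k. app T (e k) = sc (of_real (\<sigma> k)) (e k)" and "x \<in> Dom T"
  shows "diag_graph e \<sigma> x (app T x)"
  using self_adjoint_symmetric[OF assms(1,4) assms(2)]
  by (simp add: diag_graph_def assms(3) ip_scale_right)

text \<open>By symmetry \<open>T\<close> is a restriction of the diagonal operator. Conversely, a
  pair in the diagonal graph lies in the graph of the adjoint of \<open>T\<close>, which is
  \<open>T\<close> itself. Hence the domain of \<open>T\<close> is determined by the eigenvalues and
  eigenvectors.\<close>

lemma self_adjoint_eigenbasis_graph_iff:
  assumes "onb e" and "self_adjoint sc ip T"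
    and "\<And>k. e k \<in> Dom T" and "\<And>k. app T (e k) = sc (of_real (\<sigma> k)) (e k)"
  shows "diag_graph e \<sigma> x z \<longleftrightarrow> x \<in> Dom T \<and> z = app T x"
proof -
  have graph: "diag_graph e \<sigma> y (app T y)" if "y \<in> Dom T" for y
    using assms(2-4) that by (rule self_adjoint_eigenbasis_graph)
  have "x \<in> Dom T \<and> z = app T x" if "diag_graph e \<sigma> x z"
  proof -
    from that have "\<forall>y\<in>Dom T. ip (app T y) x = ip y z"
    using diag_graph_ip[OF assms(1) graph] by blast
    then show ?thesis using assms(2) unfolding self_adjoint_def by blast
  qed
  with graph show ?thesis by blast
qed

text \<open>Without a root, the choice operator in \<open>op_sqrt\<close> would return an arbitrary operator.\<close>

lemma is_op_sqrt_diag: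
  assumes "onb e" and "self_adjoint sc ip T"
    and "\<And>k. e k \<in> Dom T" and "\<And>k. app T (e k) = sc (of_real (\<sigma> k)) (e k)"
    and "\<And>k. 0 \<le> \<sigma> k"
  shows "is_op_sqrt sc ip T (diag_op e (\<lambda>k. sqrt (\<sigma> k)))"
proof -
  let ?\<rho> = "\<lambda>k. sqrt (\<sigma> k)"
  note T = self_adjoint_eigenbasis_graph_iff[OF assms(1-4)]
  note S = diag_graph_iff[OF assms(1), of ?\<rho>]
  have sq: "of_real (sqrt (\<sigma> j)) * of_real (sqrt (\<sigma> j)) = (of_real (\<sigma> j) :: 'k)" for j
    using assms(5)[of j] by (simp flip: of_real_mult)
  have comp: "diag_graph e \<sigma> x z" if "diag_graph e ?\<rho> x y" "diag_graph e ?\<rho> y z" for x y z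
    using that sq by (simp add: diag_graph_def flip: mult.assoc)
  \<comment> \<open>The intermediate vector \<open>y\<close> must have the coefficients of
    \<open>x\<close> multiplied by \<open>sqrt (\<sigma> j)\<close>. These are square-summable
    because \<open>\<sigma> j \<le> 1 + (\<sigma> j)\<^sup>2\<close>, while \<open>x\<close> and
    \<open>z\<close> have finite norm.\<close>
  have split: "\<exists>y. diag_graph e ?\<rho> x y \<and> diag_graph e ?\<rho> y z" if xz: "diag_graph e \<sigma> x z" for x z
  proof -
    have le: "\<sigma> j * t \<le> t + (\<sigma> j)\<^sup>2 * t" if "0 \<le> t" for j and t :: real
    proof -
      have "\<sigma> j \<le> 1 + (\<sigma> j)\<^sup>2" using zero_le_power2[of "\<sigma> j - 1"] assms(5)[of j]
        by (simp add: power2_eq_square algebra_simps)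
      then show ?thesis using mult_right_mono[OF _ that] by (fastforce simp: algebra_simps)
    qed
    have "summable (\<lambda>j. (norm (ip x (e j)))\<^sup>2 + (\<sigma> j)\<^sup>2 * (norm (ip x (e j)))\<^sup>2)"
      using Parseval[OF assms(1), of x] diag_graph_norm_sums[OF assms(1) xz]
      by (intro summable_add) (auto simp: sums_iff)
    then have "summable (\<lambda>j. \<sigma> j * (norm (ip x (e j)))\<^sup>2)"
      by (rule summable_comparison_test') (use assms(5) le in auto)
    then have "summable (\<lambda>j. (norm (of_real (sqrt (\<sigma> j)) * ip x (e j)))\<^sup>2)"
      using assms(5) by (simp add: norm_mult power_mult_distrib)
    then obtain y where "\<And>j. ip y (e j) = of_real (sqrt (\<sigma> j)) * ip x (e j)"
      by (rule Riesz_Fischer[OF assms(1)]) blast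
    then have "diag_graph e ?\<rho> x y \<and> diag_graph e ?\<rho> y z"
      using xz by (simp add: diag_graph_def sq flip: mult.assoc)
    then show ?thesis by blast
  qed
  have "x \<in> Dom T \<longleftrightarrow> x \<in> Dom (diag_op e ?\<rho>) \<and> app (diag_op e ?\<rho>) x \<in> Dom (diag_op e ?\<rho>)" for x
    using comp split T S by metis
  moreover have "app T x = app (diag_op e ?\<rho>) (app (diag_op e ?\<rho>) x)" if "x \<in> Dom T" for x
    using that split[of x "app T x"] T S by metis
  ultimately show ?thesis
    using nonneg_self_adjoint_diag[OF assms(1), of ?\<rho>] assms(5) by (auto simp: is_op_sqrt_def)
qed

text \<open>With \<open>w = S v - \<rho> v\<close> one has \<open>S w = - \<rho> w\<close>, and \<open>S \<ge> 0\<close> forces \<open>w = 0\<close>.\<close>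

lemma op_sqrt_eigenvector:
  assumes "is_op_sqrt sc ip T S" and "0 \<le> \<mu>" and "v \<in> Dom T" and "app T v = sc (of_real \<mu>) v"
  shows "v \<in> Dom S" and "app S v = sc (of_real (sqrt \<mu>)) v"
proof -
  have sa: "self_adjoint sc ip S" and lin: "linear_op sc S"
    and nonneg: "\<And>x. x \<in> Dom S \<Longrightarrow> 0 \<le> kre (ip (app S x) x)"
    and v: "v \<in> Dom S" and Sv: "app S v \<in> Dom S"
    and SS: "app S (app S v) = sc (of_real \<mu>) v"
    using assms by (auto simp: is_op_sqrt_def nonneg_self_adjoint_def self_adjoint_def)
  show "v \<in> Dom S" by (fact v)
  define \<rho> where "\<rho> = sqrt \<mu>"
  have \<rho>: "0 \<le> \<rho>" "\<rho> * \<rho> = \<mu>" using assms(2) by (auto simp: \<rho>_def)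
  define w where "w = app S v + sc (of_real (- \<rho>)) v"
  have sub: "subspace (Dom S)" using lin by (simp add: linear_op_def)
  have scv: "sc (of_real (- \<rho>)) v \<in> Dom S" using v sub by (rule subspace_scale[rotated])
  have w: "w \<in> Dom S" unfolding w_def using Sv scv sub by (intro subspace_add)
  have "app S w = sc (of_real \<mu>) v + sc (of_real (- \<rho>)) (app S v)"
    using lin Sv v scv SS unfolding w_def linear_op_def by metis
  also have "\<dots> = sc (of_real (- \<rho>)) w"
    unfolding w_def scale_of_real by (simp add: algebra_simps \<rho>(2))
  finally have Sw: "app S w = sc (of_real (- \<rho>)) w" .
  have "w = 0"
  \<comment> \<open>For \<open>\<rho> = 0\<close> the sign argument is empty. Symmetry helps
    instead: the squared norm of \<open>app S v\<close> is the inner product of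
    \<open>app S (app S v) = 0\<close> with \<open>v\<close>.\<close>
  proof (cases "\<rho> = 0")
    case True
    then have "app S (app S v) = 0" using SS \<rho>(2) by (simp add: scale_of_real)
    then have "ip (app S v) (app S v) = 0"
      using self_adjoint_symmetric[OF sa Sv v] by simp
    then have "app S v = 0" by (simp add: ip_self)
    then show ?thesis using True by (simp add: w_def)
  next
    case False
    have "0 \<le> inner (app S w) w" using nonneg[OF w] by (simp add: kre_ip)
    then have "\<rho> * inner w w \<le> 0" unfolding Sw scale_of_real by simp
    then have "inner w w \<le> 0" using False \<rho>(1) by (simp add: mult_le_0_iff)
    then show ?thesis by (metis inner_gt_zero_iff not_le)
  qed
  then have "app S v = - sc (of_real (- \<rho>)) v" by (simp only: w_def eq_neg_iff_add_eq_0)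
  then show "app S v = sc (of_real (sqrt \<mu>)) v"
    by (simp only: \<rho>_def scale_of_real scaleR_minus_left minus_minus)
qed

text \<open>The root inside \<open>form_dom\<close> and \<open>form_val\<close> is known only
  through its defining property. That property fixes its action on the basis, so the root scales
  coefficients by \<open>sqrt (\<sigma> j)\<close> and Parseval yields the weights
  \<open>\<sigma> j\<close>.\<close>

lemma form_eigenbasis:
  assumes "onb e" and "self_adjoint sc ip T"
    and "\<And>k. e k \<in> Dom T" and "\<And>k. app T (e k) = sc (of_real (\<sigma> k)) (e k)"
    and "\<And>k. 0 \<le> \<sigma> k"
  shows "subspace (form_dom sc ip T)" and "e k \<in> form_dom sc ip T"
    and "u \<in> form_dom sc ip T \<Longrightarrow>
      \<exists>q. form_val sc ip T u = of_real q \<and> (\<lambda>j. \<sigma> j * (norm (ip u (e j)))\<^sup>2) sums q"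
proof -
  define S where "S = op_sqrt sc ip T"
  have S: "is_op_sqrt sc ip T S"
    unfolding S_def op_sqrt_def by (rule someI) (rule is_op_sqrt_diag[OF assms])
  then have sa: "self_adjoint sc ip S" by (simp add: is_op_sqrt_def nonneg_self_adjoint_def)
  have eig: "e k \<in> Dom S" "app S (e k) = sc (of_real (sqrt (\<sigma> k))) (e k)" for k
    using S assms(5,3,4) by (rule op_sqrt_eigenvector)+
  have dom: "form_dom sc ip T = Dom S" by (simp add: form_dom_def S_def)
  show "subspace (form_dom sc ip T)" using sa by (simp add: dom self_adjoint_def linear_op_def)
  show "e k \<in> form_dom sc ip T" by (simp add: dom eig)
  assume "u \<in> form_dom sc ip T"
  then have "diag_graph e (\<lambda>k. sqrt (\<sigma> k)) u (app S u)"
    by (intro self_adjoint_eigenbasis_graph sa eig) (simp add: dom)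
  from diag_graph_norm_sums[OF assms(1) this]
  have "(\<lambda>j. \<sigma> j * (norm (ip u (e j)))\<^sup>2) sums (norm (app S u))\<^sup>2" by (simp add: assms(5))
  moreover have "form_val sc ip T u = of_real ((norm (app S u))\<^sup>2)"
    unfolding form_val_def S_def[symmetric] by (rule ip_self)
  ultimately show "\<exists>q. form_val sc ip T u = of_real q \<and> (\<lambda>j. \<sigma> j * (norm (ip u (e j)))\<^sup>2) sums q"
    by blast
qed

lemma eigenvalue_nonneg:
  assumes "nonneg_self_adjoint sc ip T" and "v \<in> Dom T" and "app T v = sc (of_real \<mu>) v"
    and "norm v = 1"
  shows "0 \<le> \<mu>"
proof -
  have "0 \<le> inner (app T v) v" using assms(1,2) by (simp add: nonneg_self_adjoint_def kre_ip)
  then show ?thesis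
    by (simp add: assms(3) scale_of_real dot_square_norm assms(4))
qed

section \<open>Test vectors for the min-max comparison\<close>

lemma onb_norm: "onb e \<Longrightarrow> norm (e i) = 1"
  using norm_onb_sum[of e "{i}" "\<lambda>_. 1"] by (simp add: abs_square_eq_1)

lemma ip_eq_0_of_span:
  assumes "onb e" and "u \<in> span (e ` {..k})" and "k < j"
  shows "ip u (e j) = 0"
  using assms(2)
proof (rule span_induct)
  show "subspace {u. ip u (e j) = 0}" by (auto simp: subspace_def ip_add_left ip_scale_left)
qed (use assms(3) in \<open>auto simp: onb_ip[OF assms(1)]\<close>)

text \<open>If projecting \<open>span {e 0, \<dots>, e k}\<close> to \<open>span {f 0, \<dots>, f (k - 1)}\<close> were injective,
  the latter would contain \<open>k + 1\<close> independent vectors.\<close>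

lemma exists_orthogonal_in_span:
  assumes "onb e" and "onb f"
  obtains u where "u \<in> span (e ` {..k})" and "u \<noteq> 0" and "\<And>j. j < k \<Longrightarrow> ip u (f j) = 0"
proof -
  let ?P = "partial_expansion f k" and ?E = "e ` {..k}"
  have "vector_space sc" by unfold_locales
  then have lin: "Vector_Spaces.linear sc sc ?P"
    by (simp add: Vector_Spaces.linear_iff partial_expansion_add partial_expansion_scale)
  interpret P: Vector_Spaces.linear sc sc ?P by (rule lin)
  \<comment> \<open>Vectors in the span of the earlier basis vectors are orthogonal to
    \<open>e (Suc n)\<close>, which has inner product 1 with itself.\<close>
  have e_new: "e (Suc n) \<notin> span (e ` {..n})" for n
    using ip_eq_0_of_span[OF assms(1), of "e (Suc n)" n "Suc n"] by (auto simp: onb_ip[OF assms(1)])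
  have indep: "independent ?E"
  proof (induction k)
    case 0
    have "e 0 \<noteq> 0" using onb_norm[OF assms(1), of 0] by auto
    then show ?case by simp
  next
    case (Suc n)
    then show ?case using e_new[of n] by (simp add: atMost_Suc independent_insertI)
  qed
  have "inj e"
    using onb_ip[OF assms(1)] by (intro injI) (metis zero_neq_one)
  have "\<not> inj_on ?P (span ?E)"
  proof
    assume inj: "inj_on ?P (span ?E)"
    have "independent (?P ` ?E)" using indep inj by (rule P.independent_injective_image)
    moreover have "?P u \<in> span (f ` {..<k})" for u
      unfolding partial_expansion_def by (intro span_sum span_scale span_base) auto
    ultimately have "card (?P ` ?E) \<le> card (f ` {..<k})"
      using independent_span_bound[of "f ` {..<k}" "?P ` ?E"] by blast
    moreover have "card (?P ` ?E) = Suc k"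
      using inj_on_subset[OF inj span_superset] inj_on_subset[OF \<open>inj e\<close> subset_UNIV]
      by (simp add: card_image)
    ultimately show False using card_image_le[of "{..<k}" f] by simp
  qed
  then obtain u where u: "u \<in> span ?E" "?P u = 0" "u \<noteq> 0"
    using P.inj_on_iff_eq_0[OF subspace_span] by blast
  have "ip u (f j) = 0" if "j < k" for j
    using ip_onb_sum[OF assms(2), of "{..<k}" "\<lambda>j. ip u (f j)" j] u(2) that
    by (simp add: partial_expansion_def)
  then show ?thesis using that u by blast
qed

end

section \<open>Comparison of the eigenvalues\<close>

theorem proposition3p3:
  fixes sc :: "'k::rc_field \<Rightarrow> 'a::{real_inner, complete_space} \<Rightarrow> 'a"
    and ip :: "'a \<Rightarrow> 'a \<Rightarrow> 'k"
    and A B :: "'a part_op"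
    and \<alpha> \<beta> :: "nat \<Rightarrow> real"
    and a b :: "nat \<Rightarrow> 'a"
    and C :: real
  assumes "hilbert_space sc ip"
    and "nonneg_self_adjoint sc ip A" and "nonneg_self_adjoint sc ip B"
    and "discrete_spectrum sc A" and "discrete_spectrum sc B"
    and "eigen_listing sc ip A \<alpha> a" and "eigen_listing sc ip B \<beta> b"
    and "\<forall>k. a k \<in> form_dom sc ip B"
    and "\<forall>k. b k \<in> Dom A"
    and "C > 0"
    and "\<forall>u \<in> form_dom sc ip B \<inter> Dom A.
           norm (ip (app A u) (app A u) - form_val sc ip B u) \<le> C * kre (ip (app A u) u)"
  shows "\<forall>k. \<bar>(\<alpha> k)\<^sup>2 - \<beta> k\<bar> \<le> C * \<alpha> k \<and> \<bar>\<alpha> k - sqrt (\<beta> k)\<bar> \<le> C"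
proof -
  interpret hilbert_space sc ip by fact
  have saA: "self_adjoint sc ip A" and saB: "self_adjoint sc ip B"
    using assms(2,3) by (auto simp: nonneg_self_adjoint_def)
  have a: "onb a" and \<alpha>: "mono \<alpha>"
    and eigA: "\<And>k. a k \<in> Dom A" "\<And>k. app A (a k) = sc (of_real (\<alpha> k)) (a k)"
    using assms(6) by (auto simp: eigen_listing_def)
  have b: "onb b" and \<beta>: "mono \<beta>"
    and eigB: "\<And>k. b k \<in> Dom B" "\<And>k. app B (b k) = sc (of_real (\<beta> k)) (b k)"
    using assms(7) by (auto simp: eigen_listing_def)
  have \<alpha>0: "0 \<le> \<alpha> k" for k using assms(2) eigA onb_norm[OF a] by (rule eigenvalue_nonneg)
  have \<beta>0: "0 \<le> \<beta> k" for k using assms(3) eigB onb_norm[OF b] by (rule eigenvalue_nonneg)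
  note form = form_eigenbasis[OF b saB eigB \<beta>0]
  have subA: "subspace (Dom A)" using saA by (simp add: self_adjoint_def linear_op_def)
  have mono_sq: "(\<alpha> i)\<^sup>2 \<le> (\<alpha> j)\<^sup>2" if "i \<le> j" for i j
    using \<alpha> \<alpha>0 that by (simp add: monoD power_mono)
  \<comment> \<open>On the common domain every form becomes a weighted sum of squared coefficients:
    \<open>q\<close> is the form of \<open>B\<close>, \<open>p\<close> is \<open>(Au,Au)\<close> and
    \<open>r\<close> is \<open>(Au,u)\<close>.\<close>
  have key: "\<exists>q p r. (\<lambda>j. \<beta> j * (norm (ip u (b j)))\<^sup>2) sums q
      \<and> (\<lambda>j. (\<alpha> j)\<^sup>2 * (norm (ip u (a j)))\<^sup>2) sums p
      \<and> (\<lambda>j. \<alpha> j * (norm (ip u (a j)))\<^sup>2) sums r \<and> \<bar>p - q\<bar> \<le> C * r"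
    if u: "u \<in> form_dom sc ip B" "u \<in> Dom A" for u
  proof -
    have graph: "diag_graph a \<alpha> u (app A u)"
      using saA eigA u(2) by (rule self_adjoint_eigenbasis_graph)
    obtain q where q: "form_val sc ip B u = of_real q" "(\<lambda>j. \<beta> j * (norm (ip u (b j)))\<^sup>2) sums q"
      using form(3)[OF u(1)] by blast
    have "ip (app A u) (app A u) - form_val sc ip B u = of_real ((norm (app A u))\<^sup>2 - q)"
      by (simp only: q(1) ip_self of_real_diff)
    then have "\<bar>(norm (app A u))\<^sup>2 - q\<bar> \<le> C * kre (ip (app A u) u)"
      using assms(11) u by (metis IntI norm_of_real)
    then show ?thesis
      using q(2) diag_graph_norm_sums[OF a graph] diag_graph_inner_sums[OF a graph] by blast
  qed
  have upper: "\<beta> k \<le> (\<alpha> k)\<^sup>2 + C * \<alpha> k" for k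
  proof -
    obtain u where u: "u \<in> span (a ` {..k})" "u \<noteq> 0" "\<And>j. j < k \<Longrightarrow> ip u (b j) = 0"
      using exists_orthogonal_in_span[OF a b] by blast
    \<comment> \<open>Both domains are subspaces, so it suffices that they contain the
      \<open>a i\<close>; for the form domain of \<open>B\<close> this is the extra hypothesis on
      the eigenvectors.\<close>
    have "span (a ` {..k}) \<subseteq> form_dom sc ip B" "span (a ` {..k}) \<subseteq> Dom A"
      by (intro span_minimal form(1) subA; use assms(8) eigA in blast)+
    then have "u \<in> form_dom sc ip B" "u \<in> Dom A" using u(1) by blast+
    from key[OF this] obtain q p r where q: "(\<lambda>j. \<beta> j * (norm (ip u (b j)))\<^sup>2) sums q"
      and p: "(\<lambda>j. (\<alpha> j)\<^sup>2 * (norm (ip u (a j)))\<^sup>2) sums p"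
      and r: "(\<lambda>j. \<alpha> j * (norm (ip u (a j)))\<^sup>2) sums r" and le: "\<bar>p - q\<bar> \<le> C * r"
      by blast
    \<comment> \<open>Termwise comparison: the coefficients with \<open>j < k\<close> vanish by the
      choice of \<open>u\<close>, and the remaining weights are at least
      \<open>\<beta> k\<close>.\<close>
    have "\<beta> k * (norm u)\<^sup>2 \<le> q"
    proof (rule sums_le[OF _ sums_mult[OF Parseval[OF b, of u]] q])
      show "\<beta> k * (norm (ip u (b j)))\<^sup>2 \<le> \<beta> j * (norm (ip u (b j)))\<^sup>2" for j
        by (cases "j < k") (auto simp: u(3) intro!: mult_right_mono monoD[OF \<beta>])
    qed
    also have "q \<le> p + C * r" using le by linarith
    \<comment> \<open>Here the coefficients with \<open>j > k\<close> vanish, since \<open>u\<close>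
      lies in the span of \<open>a 0\<close> to \<open>a k\<close>.\<close>
    also have "p + C * r \<le> ((\<alpha> k)\<^sup>2 + C * \<alpha> k) * (norm u)\<^sup>2"
    proof (rule sums_le[OF _ sums_add[OF p sums_mult[OF r, of C]] sums_mult[OF Parseval[OF a]]])
      show "(\<alpha> j)\<^sup>2 * (norm (ip u (a j)))\<^sup>2 + C * (\<alpha> j * (norm (ip u (a j)))\<^sup>2)
          \<le> ((\<alpha> k)\<^sup>2 + C * \<alpha> k) * (norm (ip u (a j)))\<^sup>2" for j
      proof (cases "k < j")
        case False
        then have "(\<alpha> j)\<^sup>2 + C * \<alpha> j \<le> (\<alpha> k)\<^sup>2 + C * \<alpha> k"
          using mono_sq[of j k] monoD[OF \<alpha>, of j k] \<open>C > 0\<close> by (simp add: add_mono)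
        from mult_right_mono[OF this zero_le_power2, of "norm (ip u (a j))"] show ?thesis by (simp add: algebra_simps)
      qed (simp add: ip_eq_0_of_span[OF a u(1)])
    qed
    finally show ?thesis using u(2) by simp
  qed
  have lower: "(\<alpha> k)\<^sup>2 - C * \<alpha> k \<le> \<beta> k" for k
  proof (cases "\<alpha> k < C")
    case True
    then have "\<alpha> k * \<alpha> k \<le> C * \<alpha> k" using \<alpha>0[of k] by (intro mult_right_mono) auto
    then show ?thesis using \<beta>0[of k] by (simp add: power2_eq_square)
  next
    case False
    obtain u where u: "u \<in> span (b ` {..k})" "u \<noteq> 0" "\<And>j. j < k \<Longrightarrow> ip u (a j) = 0"
      using exists_orthogonal_in_span[OF b a] by blast
    have "span (b ` {..k}) \<subseteq> form_dom sc ip B" "span (b ` {..k}) \<subseteq> Dom A"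
      by (intro span_minimal form(1) subA; use assms(9) form(2) in blast)+
    then have "u \<in> form_dom sc ip B" "u \<in> Dom A" using u(1) by blast+
    from key[OF this] obtain q p r where q: "(\<lambda>j. \<beta> j * (norm (ip u (b j)))\<^sup>2) sums q"
      and p: "(\<lambda>j. (\<alpha> j)\<^sup>2 * (norm (ip u (a j)))\<^sup>2) sums p"
      and r: "(\<lambda>j. \<alpha> j * (norm (ip u (a j)))\<^sup>2) sums r" and le: "\<bar>p - q\<bar> \<le> C * r"
      by blast
    have "((\<alpha> k)\<^sup>2 - C * \<alpha> k) * (norm u)\<^sup>2 \<le> p - C * r"
    proof (rule sums_le[OF _ sums_mult[OF Parseval[OF a]] sums_diff[OF p sums_mult[OF r, of C]]])
      show "((\<alpha> k)\<^sup>2 - C * \<alpha> k) * (norm (ip u (a j)))\<^sup>2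
          \<le> (\<alpha> j)\<^sup>2 * (norm (ip u (a j)))\<^sup>2 - C * (\<alpha> j * (norm (ip u (a j)))\<^sup>2)" for j
      proof (cases "j < k")
        case False
        \<comment> \<open>For \<open>t \<ge> C\<close> both factors of \<open>t * (t - C)\<close>
          are non-negative and increasing; this is where \<open>\<alpha> k \<ge> C\<close>
          enters.\<close>
        then have "\<alpha> k * (\<alpha> k - C) \<le> \<alpha> j * (\<alpha> j - C)"
          using monoD[OF \<alpha>, of k j] \<alpha>0 \<open>\<not> \<alpha> k < C\<close> by (intro mult_mono) auto
        from mult_right_mono[OF this zero_le_power2, of "norm (ip u (a j))"] show ?thesis
          by (simp add: algebra_simps power2_eq_square)
      qed (simp add: u(3))
    qed
    also have "p - C * r \<le> q" using le by linarith
    also have "q \<le> \<beta> k * (norm u)\<^sup>2"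
    proof (rule sums_le[OF _ q sums_mult[OF Parseval[OF b]]])
      show "\<beta> j * (norm (ip u (b j)))\<^sup>2 \<le> \<beta> k * (norm (ip u (b j)))\<^sup>2" for j
        by (cases "k < j")
          (auto simp: ip_eq_0_of_span[OF b u(1)] intro!: mult_right_mono monoD[OF \<beta>])
    qed
    finally show ?thesis using u(2) by simp
  qed
  show ?thesis
  proof (intro allI conjI)
    fix k
    show le: "\<bar>(\<alpha> k)\<^sup>2 - \<beta> k\<bar> \<le> C * \<alpha> k" using upper[of k] lower[of k] by linarith
    define s where "s = sqrt (\<beta> k)"
    have s: "0 \<le> s" "\<beta> k = s\<^sup>2" using \<beta>0[of k] by (auto simp: s_def)
    \<comment> \<open>The difference of squares factors, and the first estimate is weakened from
      \<open>C * \<alpha> k\<close> to \<open>C * (\<alpha> k + s)\<close> so that the common factor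
      can be cancelled.\<close>
    have "\<bar>\<alpha> k - s\<bar> * (\<alpha> k + s) = \<bar>(\<alpha> k)\<^sup>2 - s\<^sup>2\<bar>"
      using \<alpha>0[of k] s(1) by (simp add: power2_eq_square square_diff_square_factored abs_mult)
    also have "\<dots> \<le> C * (\<alpha> k + s)" using le s \<open>C > 0\<close> by (simp add: distrib_left add_increasing2)
    finally have "\<bar>\<alpha> k - s\<bar> * (\<alpha> k + s) \<le> C * (\<alpha> k + s)" .
    \<comment> \<open>If \<open>\<alpha> k + s\<close> is not positive, both summands are zero and
      the claim reduces to \<open>C > 0\<close>.\<close>
    then have "\<bar>\<alpha> k - s\<bar> \<le> C" if "0 < \<alpha> k + s"
      using that by (rule mult_right_le_imp_le)
    then show "\<bar>\<alpha> k - sqrt (\<beta> k)\<bar> \<le> C"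
      using \<alpha>0[of k] s(1) \<open>C > 0\<close> unfolding s_def[symmetric] by linarith
  qed
qed

end
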